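(* No primorial prime number is both plus-primorial and minus-primorial. That is, if $p$ is a primorial prime number, then $p$ is not simultaneously plus-primorial and minus-primorial.
   Context: Let $p_1 = 2, p_2 = 3, p_3 = 5, \dots$ denote the prime numbers in increasing order. A prime number $p$ is called primorial if it is one more or one less than the product of the first $n$ prime numbers for some $n \in \{1,2,\dots\}$, i.e. $p = p_1 p_2 \cdots p_n + 1$ or $p = p_1 p_2 \cdots p_n - 1$ for some integer $n \ge 1$. A prime number $p$ is called plus-primorial if $p = p_1 p_2 \cdots p_n + 1$ for some integer $n \ge 1$. A prime number $p$ is called minus-primorial if $p = p_1 p_2 \cdots p_n - 1$ for some integer $n \ge 1$. The value of $n$ in the plus-primorial condition and the value of $n$ in the minus-primorial condition are not required to be equal. *)

theory Defs
  imports "HOL-Library.Infinite_Set" "HOL-Computational_Algebra.Primes"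
begin

text \<open>The increasing enumeration of the primes is indexed from 0 here:
  \<open>nth_prime 0 = 2\<close>, \<open>nth_prime 1 = 3\<close>, so that \<open>nth_prime k\<close> is usually written $p_{k+1}$.\<close>

definition nth_prime :: "nat \<Rightarrow> nat" where
  "nth_prime k = enumerate {p. prime p} k"

definition prime_product :: "nat \<Rightarrow> nat" where
  "prime_product n = (\<Prod>k<n. nth_prime k)"

definition plus_primorial :: "nat \<Rightarrow> bool" where
  "plus_primorial p \<longleftrightarrow> prime p \<and> (\<exists>n\<ge>1. p = prime_product n + 1)"

text \<open>The subtraction on \<^typ>\<open>nat\<close> below never truncates, since every
  \<open>prime_product n\<close> is positive.\<close>

definition minus_primorial :: "nat \<Rightarrow> bool" where
  "minus_primorial p \<longleftrightarrow> prime p \<and> (\<exists>n\<ge>1. p = prime_product n - 1)"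

definition primorial :: "nat \<Rightarrow> bool" where
  "primorial p \<longleftrightarrow>
    prime p \<and> (\<exists>n\<ge>1. p = prime_product n + 1 \<or> p = prime_product n - 1)"

end

theory Submission
  imports Defs
begin

text \<open>A prime of both kinds gives two primorial products differing by 2. By
  \<open>prime_product_eq_double_odd\<close> their halves are odd, as 2 occurs exactly once among
  the factors, yet these halves would be consecutive.\<close>

text \<open>For \<open>n \<ge> 1\<close> the product of the first \<open>n\<close> primes is twice an odd number, so two such
  products are congruent modulo 4 and cannot differ by 2.\<close>

lemma nth_prime_0: "nth_prime 0 = 2"
  unfolding nth_prime_def enumerate_0
  by (rule Least_equality) (auto simp: two_is_prime_nat dest: prime_ge_2_nat)

lemma prime_nth_prime: "prime (nth_prime k)"
  using enumerate_in_set[OF primes_infinite] by (simp add: nth_prime_def)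

lemma odd_nth_prime_Suc: "odd (nth_prime (Suc k))"
proof -
  have "nth_prime 0 < nth_prime (Suc k)"
    unfolding nth_prime_def by (intro enumerate_mono primes_infinite) simp
  then show ?thesis
    using prime_nth_prime nth_prime_0 by (simp add: prime_odd_nat)
qed

lemma prime_product_eq_double_odd:
  assumes "n \<ge> 1"
  obtains a where "odd a" "prime_product n = 2 * a"
proof
  show "odd (\<Prod>k<n - 1. nth_prime (Suc k))"
    by (simp add: even_prod_iff odd_nth_prime_Suc)
  show "prime_product n = 2 * (\<Prod>k<n - 1. nth_prime (Suc k))"
    \<comment> \<open>\<open>n \<ge> 1\<close> makes \<open>n\<close> the successor of
      \<open>n - 1\<close>, so the factor 2 at index 0 splits off.\<close>
    using assms prod.lessThan_Suc_shift[of nth_prime "n - 1"]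
    by (simp add: prime_product_def nth_prime_0)
qed

theorem proposition1p7:
  fixes p :: nat
  assumes "primorial p"
  shows "\<not> (plus_primorial p \<and> minus_primorial p)"
proof
  assume "plus_primorial p \<and> minus_primorial p"
  then obtain m n where mn: "m \<ge> 1" "n \<ge> 1"
    and p: "p = prime_product m + 1" "p = prime_product n - 1"
    unfolding plus_primorial_def minus_primorial_def by blast
  obtain a where a: "odd a" "prime_product m = 2 * a"
    using mn(1) by (rule prime_product_eq_double_odd)
  obtain b where b: "odd b" "prime_product n = 2 * b"
    using mn(2) by (rule prime_product_eq_double_odd)
  \<comment> \<open>Truncation would force \<open>p = 0\<close>, but \<open>p = 2 * a + 1\<close>;
    hence \<open>2 * a + 1 = 2 * b - 1\<close> holds as for integers.\<close>
  have "b = a + 1"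
    using p a(2) b(2) by linarith
  with a(1) b(1) show False
    by simp
qed

end
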